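(* Let $v_1,\ldots,v_n$ be a set of vectors in $\mathbb{N}^n$ such that $|v_i|=d\geq 1$ for all $i$ and $\det(A)=\pm d$, where $A$ is the $n\times n$ matrix with column vectors $v_1,\ldots,v_n$. Then there are unique vectors $\beta_1,\ldots,\beta_n,\gamma\in\mathbb{N}^n$ such that the following two conditions hold: (a) $A\beta_i=\gamma+e_i$ for all $i$, where $\beta_i,\gamma$ and $e_i$ are regarded as column vectors; (b) the matrix $B$ whose columns are $\beta_1,\ldots,\beta_n$ has at least one zero entry in every row. Moreover, $\det(B)=\pm(|\gamma|+1)/d=\pm|\beta_i|$ for all $i$.
   Context: $\mathbb{N}$ denotes the non-negative integers. For $a=(a_1,\ldots,a_n)\in\mathbb{R}^n$, $|a|=a_1+\cdots+a_n$. $e_i$ denotes the $i$th unit vector of $\mathbb{R}^n$. The notation $\det(M)=\pm c$ means $\det(M)\in\{c,-c\}$.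
   Formalization: The formal theorem assumes n ≥ 2: for n = 1 the claim is false, since v_1 = (d) has determinant d, condition (b) forces β_1 = 0, and then (a) reads 0 = γ + 1, which is impossible in the non-negative integers. *)

theory Defs
  imports "HOL-Analysis.Analysis"
begin

definition vec_size :: "nat ^ 'n \<Rightarrow> nat" where
  "vec_size a = (\<Sum>i\<in>UNIV. a $ i)"

definition matrix_of_columns :: "('n \<Rightarrow> 'a ^ 'm) \<Rightarrow> 'a ^ 'n ^ 'm" where
  "matrix_of_columns v = (\<chi> i j. v j $ i)"

(* Matrices of natural numbers have no determinant in the library, whose det
   needs a commutative ring; it is taken after embedding the entries in the reals. *)
definition det_nat :: "nat ^ 'n ^ 'n \<Rightarrow> real" where
  "det_nat M = det (map_matrix real M)"

(* Conditions (a) and (b). For a single vector (n = 1) they cannot hold together: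
   (b) forces beta = 0, and then (a) reads 0 = gamma + 1. *)
definition inversion_data ::
    "('n \<Rightarrow> nat ^ 'n) \<Rightarrow> ('n \<Rightarrow> nat ^ 'n) \<Rightarrow> nat ^ 'n \<Rightarrow> bool" where
  "inversion_data v \<beta> \<gamma> \<longleftrightarrow>
     (\<forall>i. matrix_of_columns v *v \<beta> i = \<gamma> + axis i 1) \<and>
     (\<forall>k. \<exists>j. matrix_of_columns \<beta> $ k $ j = 0)"

end

theory Submission
  imports Defs
begin

text \<open>
  Since every column of \<open>A\<close> sums to \<open>d\<close> and \<open>det A = \<plusminus>d\<close>, a vector with zero coordinate sum is
  the image under \<open>A\<close> of an integer vector: in Cramer's rule, adding all rows of the numerator matrix
  to one of them produces a row divisible by \<open>d\<close>.  Hence the differences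
  \<open>\<beta>\<^sub>i - \<beta>\<^sub>j = A\<^sup>-\<^sup>1 (e\<^sub>i - e\<^sub>j)\<close> are forced and integral, and condition (b) fixes the common
  translation by making every row minimum of \<open>B\<close> equal to zero.  The determinant of \<open>B\<close> comes from
  \<open>A B = I + \<gamma> 1\<^sup>T\<close>, whose determinant is \<open>1 + |\<gamma>|\<close>, and from
  \<open>d |\<beta>\<^sub>i| = |A \<beta>\<^sub>i| = |\<gamma>| + 1\<close>.
\<close>

section \<open>Determinant identities\<close>

lemma det_in_Ints:
  fixes M :: "'a::comm_ring_1 ^ 'n ^ 'n"
  assumes "\<And>i j. M $ i $ j \<in> \<int>"
  shows "det M \<in> \<int>"
  unfolding det_def by (intro Ints_sum Ints_mult Ints_prod assms Ints_of_int)

text \<open>Adding all other rows to one row keeps the determinant and turns that row into the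
  column sums. The factor \<open>c\<close> comes out of it, and an integer matrix remains.\<close>

lemma det_div_column_sum_divisor_in_Ints:
  fixes M :: "'a::field ^ 'n ^ 'n"
  assumes ints: "\<And>i j. M $ i $ j \<in> \<int>"
    and col: "\<And>j. (\<Sum>i\<in>UNIV. M $ i $ j) / c \<in> \<int>" and "c \<noteq> 0"
  shows "det M / c \<in> \<int>"
proof -
  fix r :: 'n
  define s where "s = (\<chi> j. (\<Sum>i\<in>UNIV. M $ i $ j) / c)"
  have sum_rows: "(\<Sum>i\<in>UNIV. (\<chi> i. 1) $ i *s row i M) = c *s s"
    using \<open>c \<noteq> 0\<close> by (simp add: vec_eq_iff s_def row_def)
  \<comment> \<open>Transposed Cramer: replacing row \<open>r\<close> by a combination of the rows
    multiplies the determinant by the coefficient of row \<open>r\<close>, here 1.\<close>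
  have "det M = det (\<chi> i. if i = r then c *s s else row i M)"
    using cramer_lemma_transpose[of r "\<chi> i. 1" M] by (simp only: sum_rows) simp
  also have "\<dots> = c * det (\<chi> i. if i = r then s else row i M)"
    by (rule det_row_mul)
  finally have "det M / c = det (\<chi> i. if i = r then s else row i M)"
    using \<open>c \<noteq> 0\<close> by simp
  also have "\<dots> \<in> \<int>"
    using ints col by (intro det_in_Ints) (auto simp: s_def row_def)
  finally show ?thesis .
qed

text \<open>This is \<open>det (I + u 1^T)\<close>. Taking the coordinate sum as new coordinate
  \<open>r\<close> turns \<open>1^T\<close> into a unit covector, so the matrix becomes similar to
  the identity with one column changed.\<close>

lemma det_identity_plus_constant_rows:
  fixes u :: "'a::field ^ 'n"
  shows "det (\<chi> i j. u $ i + (if i = j then 1 else 0)) = 1 + (\<Sum>i\<in>UNIV. u $ i)"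
proof -
  fix r :: 'n
  let ?C = "\<chi> i j. u $ i + (if i = j then 1 else 0) :: 'a ^ 'n ^ 'n"
  \<comment> \<open>\<open>P\<close> sums all coordinates into coordinate \<open>r\<close>, and
    \<open>w\<close> is \<open>P u\<close> plus the unit vector at \<open>r\<close>. Thus
    \<open>E\<close> is \<open>?C\<close> conjugated by \<open>P\<close>.\<close>
  define w where "w = (\<chi> i. if i = r then 1 + (\<Sum>i\<in>UNIV. u $ i) else u $ i)"
  define P :: "'a ^ 'n ^ 'n" where "P = (\<chi> i j. if i = r then 1 else if i = j then 1 else 0)"
  define E :: "'a ^ 'n ^ 'n" where "E = (\<chi> i j. if j = r then w $ i else if i = j then 1 else 0)"
  have column: "det (\<chi> i j. if j = r then x $ i else if i = j then 1 else 0) = x $ r" for x :: "'a ^ 'n"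
    using cramer_lemma[where A = "mat 1" and x = x and k = r]
    by (simp only: matrix_vector_mul_lid det_I) (simp add: mat_def cong: if_cong)
  have detE: "det E = w $ r"
    using column[of w] by (simp add: E_def)
  have "transpose P = (\<chi> i j. if j = r then (\<chi> i. 1) $ i else if i = j then 1 else 0)"
    by (simp add: vec_eq_iff transpose_def P_def)
  then have "det (transpose P) = 1"
    by (simp only: column) simp
  then have detP: "det P = 1"
    by (simp only: det_transpose)
  have "P ** ?C = E ** P"
  proof -
    have "(\<Sum>k\<in>UNIV. P $ i $ k * ?C $ k $ j) = (\<Sum>k\<in>UNIV. E $ i $ k * P $ k $ j)" for i j
    proof -
      \<comment> \<open>Row \<open>i\<close> of \<open>E\<close> is supported at \<open>r\<close>
        and \<open>i\<close>; the inner conditional avoids counting the entry twice when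
        \<open>i = r\<close>.\<close>
      have "(\<Sum>k\<in>UNIV. E $ i $ k * P $ k $ j)
          = (\<Sum>k\<in>UNIV. (if k = r then w $ i else 0) + (if k = i then (if i = r then 0 else P $ i $ j) else 0))"
        by (intro sum.cong) (auto simp: E_def P_def)
      also have "\<dots> = w $ i + (if i = r then 0 else P $ i $ j)"
        by (simp add: sum.distrib)
      also have "\<dots> = (\<Sum>k\<in>UNIV. P $ i $ k * ?C $ k $ j)"
        by (simp add: P_def w_def sum.distrib if_distrib[of "\<lambda>x. x * _"] cong: if_cong)
      finally show ?thesis by simp
    qed
    then show ?thesis
      by (simp add: vec_eq_iff matrix_matrix_mult_def)
  qed
  then have "det (P ** ?C) = det (E ** P)"
    by (rule arg_cong)
  then have "det P * det ?C = det E * det P"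
    by (simp only: det_mul)
  then show ?thesis
    by (simp add: detE detP w_def)
qed

section \<open>Coordinate sums and integral preimages\<close>

lemma sum_matrix_vector_mult_const_column_sum:
  fixes A :: "'a::comm_semiring_1 ^ 'n ^ 'm"
  assumes "\<And>j. (\<Sum>i\<in>UNIV. A $ i $ j) = c"
  shows "(\<Sum>i\<in>UNIV. (A *v x) $ i) = c * (\<Sum>j\<in>UNIV. x $ j)"
proof -
  have "(\<Sum>i\<in>UNIV. (A *v x) $ i) = (\<Sum>j\<in>UNIV. \<Sum>i\<in>UNIV. A $ i $ j * x $ j)"
    unfolding matrix_vector_mult_def by (simp add: sum.swap[of "\<lambda>i j. A $ i $ j * x $ j"])
  then show ?thesis
    by (simp add: assms sum_distrib_left flip: sum_distrib_right)
qed

text \<open>The Cramer numerators \<open>?N k\<close> have column sums 0 or \<open>c\<close>, so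
  \<open>c\<close> divides their determinants, and \<open>det A\<close> is \<open>c\<close> up to
  sign.\<close>

lemma integral_preimage_of_zero_sum:
  fixes A :: "real ^ 'n ^ 'n" and b :: "real ^ 'n"
  assumes ints: "\<And>i j. A $ i $ j \<in> \<int>" and col: "\<And>j. (\<Sum>i\<in>UNIV. A $ i $ j) = c"
    and det: "det A \<in> {c, - c}" and "c \<noteq> 0"
    and b_ints: "\<And>i. b $ i \<in> \<int>" and b_sum: "(\<Sum>i\<in>UNIV. b $ i) = 0"
  obtains x :: "int ^ 'n" where "A *v (\<chi> k. of_int (x $ k)) = b"
proof -
  let ?N = "\<lambda>k. \<chi> i j. if j = k then b $ i else A $ i $ j"
  have "det (?N k) / c \<in> \<int>" for k
  proof (rule det_div_column_sum_divisor_in_Ints)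
    fix j
    show "(\<Sum>i\<in>UNIV. ?N k $ i $ j) / c \<in> \<int>"
      using b_sum col \<open>c \<noteq> 0\<close> by (cases "j = k") auto
  qed (use ints b_ints \<open>c \<noteq> 0\<close> in auto)
  then have "det (?N k) / det A \<in> \<int>" for k
    using det by (auto simp: minus_in_Ints_iff)
  then have "\<forall>k. \<exists>z. det (?N k) / det A = of_int z"
    by (blast elim: Ints_cases)
  then obtain x where x: "\<And>k. det (?N k) / det A = of_int (x k)"
    unfolding choice_iff by blast
  have "det A \<noteq> 0"
    using det \<open>c \<noteq> 0\<close> by auto
  then have "A *v (\<chi> k. of_int ((\<chi> k. x k) $ k)) = b"
    by (subst cramer) (simp_all add: x)
  then show ?thesis
    by (rule that)
qed

section \<open>Uniqueness and existence\<close>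

lemma inversion_data_entry:
  assumes "inversion_data v \<beta> \<gamma>"
  shows "(\<Sum>j\<in>UNIV. v j $ k * \<beta> i $ j) = \<gamma> $ k + (if k = i then 1 else 0)"
proof -
  have "(matrix_of_columns v *v \<beta> i) $ k = (\<gamma> + axis i 1) $ k"
    using assms by (simp add: inversion_data_def)
  then show ?thesis
    by (simp add: matrix_vector_mult_def matrix_of_columns_def axis_def)
qed

lemma inversion_data_unique:
  fixes v :: "'n::finite \<Rightarrow> nat ^ 'n"
  assumes det: "det_nat (matrix_of_columns v) \<noteq> 0"
    and 1: "inversion_data v \<beta> \<gamma>" and 2: "inversion_data v \<beta>' \<gamma>'"
  shows "\<beta> = \<beta>'" and "\<gamma> = \<gamma>'"
proof -
  let ?A = "map_matrix real (matrix_of_columns v)"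
  have A_inj: "x = 0" if "?A *v x = 0" for x
    using that det cramer[of ?A x 0] cramer[of ?A 0 0] by (simp add: det_nat_def)
  have diff: "real (\<beta> i $ k) - real (\<beta> j $ k) = real (\<beta>' i $ k) - real (\<beta>' j $ k)" for i j k
  proof -
    have entry: "(\<Sum>l\<in>UNIV. real (v l $ k) * real (\<beta> i $ l)) = real (\<gamma> $ k) + (if k = i then 1 else 0)"
      if "inversion_data v \<beta> \<gamma>" for \<beta> \<gamma> i k
      using arg_cong[OF inversion_data_entry[OF that, of k i], of real] by simp
    \<comment> \<open>In this double difference both \<gamma> and \<gamma>' cancel under
      \<open>?A\<close>, and so do the unit vectors.\<close>
    define x :: "real ^ 'n" where
      "x = (\<chi> k. real (\<beta> i $ k) - real (\<beta> j $ k) - (real (\<beta>' i $ k) - real (\<beta>' j $ k)))"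
    have "?A *v x = 0"
      by (simp add: vec_eq_iff matrix_vector_mult_def map_matrix_def matrix_of_columns_def x_def
          right_diff_distrib sum_subtractf entry[OF 1] entry[OF 2])
    then have "x = 0"
      by (rule A_inj)
    then have "x $ k = 0"
      by simp
    then show ?thesis
      by (simp add: x_def)
  qed
  show "\<beta> = \<beta>'"
  proof
    fix i
    have "\<beta> i $ k = \<beta>' i $ k" for k
    proof -
      have zero: "\<exists>j. \<beta> j $ k = 0" if "inversion_data v \<beta> \<gamma>" for \<beta> \<gamma>
        using that by (simp add: inversion_data_def matrix_of_columns_def)
      obtain j j' where "\<beta> j $ k = 0" "\<beta>' j' $ k = 0"
        using zero[OF 1] zero[OF 2] by blast
      \<comment> \<open>Naturals are nonnegative, so the zero at \<open>j\<close> gives one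
        inequality between the entries and the zero at \<open>j'\<close> the other.\<close>
      then show ?thesis
        using diff[of i k j] diff[of i k j'] by linarith
    qed
    then show "\<beta> i = \<beta>' i"
      by (simp add: vec_eq_iff)
  qed
  then show "\<gamma> = \<gamma>'"
    using inversion_data_entry[OF 1] inversion_data_entry[OF 2]
    by (metis add_right_cancel vec_eq_iff)
qed

text \<open>Integral solutions \<open>D i\<close> for the differences from a reference index
  \<open>r\<close> are shifted by their coordinatewise minimum \<open>m\<close>, which makes them
  nonnegative with a zero in each row.\<close>

lemma inversion_data_exists:
  fixes v :: "'n::finite \<Rightarrow> nat ^ 'n"
  assumes card: "CARD('n) \<ge> 2" and d: "d \<ge> 1" and size: "\<And>i. vec_size (v i) = d"
    and det: "det_nat (matrix_of_columns v) \<in> {real d, - real d}"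
  shows "\<exists>\<beta> \<gamma>. inversion_data v \<beta> \<gamma>"
proof -
  fix r :: 'n
  let ?A = "map_matrix real (matrix_of_columns v)"
  have "\<exists>x :: int ^ 'n. ?A *v (\<chi> k. of_int (x $ k)) = axis i 1 - axis r 1" for i
  proof (rule integral_preimage_of_zero_sum)
    show "(\<Sum>k\<in>UNIV. ?A $ k $ j) = real d" for j
      using size[of j]
      by (simp add: map_matrix_def matrix_of_columns_def vec_size_def flip: of_nat_sum)
    show "(\<Sum>k\<in>UNIV. (axis i 1 - axis r 1 :: real ^ 'n) $ k) = 0"
      by (simp add: sum_subtractf axis_def)
  qed (use d det in \<open>auto simp: map_matrix_def matrix_of_columns_def det_nat_def axis_def\<close>)
  then obtain D :: "'n \<Rightarrow> int ^ 'n" where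
    D: "\<And>i. ?A *v (\<chi> k. of_int (D i $ k)) = axis i 1 - axis r 1"
    using choice[of "\<lambda>i x. ?A *v (\<chi> k. of_int (x $ k)) = axis i 1 - axis r 1"] by blast
  have D_entry: "(\<Sum>j\<in>UNIV. int (v j $ k) * D i $ j) = (if k = i then 1 else 0) - (if k = r then 1 else 0)"
    for i k
  proof -
    have "real_of_int (\<Sum>j\<in>UNIV. int (v j $ k) * D i $ j) = (axis i 1 - axis r 1 :: real ^ 'n) $ k"
      by (simp add: map_matrix_def matrix_of_columns_def matrix_vector_mult_def flip: D)
    also have "\<dots> = real_of_int ((if k = i then 1 else 0) - (if k = r then 1 else 0))"
      by (simp add: axis_def)
    finally show ?thesis
      by (simp only: of_int_eq_iff)
  qed
  define m where "m k = Min (range (\<lambda>i. D i $ k))" for k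
  have m_le: "m k \<le> D i $ k" for i k
    by (simp add: m_def)
  have m_attained: "\<exists>i. D i $ k = m k" for k
  proof -
    have "m k \<in> range (\<lambda>i. D i $ k)"
      unfolding m_def by (rule Min_in) auto
    then show ?thesis
      by auto
  qed
  \<comment> \<open>Forced by the shift: A(\<open>D i\<close> - \<open>m\<close>) is the unit vector
    at \<open>i\<close> plus \<open>c\<close>. The signs of \<open>c\<close> are still open.\<close>
  define c where "c k = - (\<Sum>j\<in>UNIV. int (v j $ k) * m j) - (if k = r then 1 else 0)" for k
  define \<beta> :: "'n \<Rightarrow> nat ^ 'n" where "\<beta> i = (\<chi> k. nat (D i $ k - m k))" for i
  define \<gamma> :: "nat ^ 'n" where "\<gamma> = (\<chi> k. nat (c k))"
  have A\<beta>: "int (\<Sum>j\<in>UNIV. v j $ k * \<beta> i $ j) = c k + (if k = i then 1 else 0)" for i k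
    by (simp add: \<beta>_def m_le right_diff_distrib sum_subtractf D_entry c_def)
  \<comment> \<open>Some \<open>i\<close> differs from \<open>k\<close> because there are at least
    two indices. There the unit vector vanishes, and \<open>c k\<close> is a sum of
    naturals.\<close>
  have c_nonneg: "c k \<ge> 0" for k
  proof -
    have "\<exists>i. i \<noteq> k"
    proof (rule ccontr)
      assume "\<nexists>i. i \<noteq> k"
      then have "(UNIV :: 'n set) = {k}" by auto
      then have "CARD('n) = card {k}" by (rule arg_cong)
      then show False using card by simp
    qed
    then obtain i where "k \<noteq> i" by fastforce
    then have "c k = int (\<Sum>j\<in>UNIV. v j $ k * \<beta> i $ j)"
      unfolding A\<beta> by simp
    then show ?thesis
      by (simp only: of_nat_0_le_iff)
  qed
  have "(matrix_of_columns v *v \<beta> i) $ k = (\<gamma> + axis i 1) $ k" for i k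
  proof -
    have "int ((matrix_of_columns v *v \<beta> i) $ k) = c k + (if k = i then 1 else 0)"
      using A\<beta>[of k i] by (simp add: matrix_vector_mult_def matrix_of_columns_def)
    also have "\<dots> = int ((\<gamma> + axis i 1) $ k)"
      using c_nonneg[of k] by (simp add: \<gamma>_def axis_def)
    finally show ?thesis by simp
  qed
  moreover have "\<exists>j. \<beta> j $ k = 0" for k
    using m_attained[of k] by (auto simp: \<beta>_def intro: eq_refl)
  ultimately have "inversion_data v \<beta> \<gamma>"
    by (simp add: inversion_data_def vec_eq_iff matrix_of_columns_def)
  then show ?thesis by blast
qed

section \<open>Size and determinant of the solution\<close>

lemma inversion_data_size:
  fixes v :: "'n::finite \<Rightarrow> nat ^ 'n"
  assumes size: "\<And>i. vec_size (v i) = d" and inv: "inversion_data v \<beta> \<gamma>"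
  shows "d * vec_size (\<beta> i) = vec_size \<gamma> + 1"
proof -
  have "d * vec_size (\<beta> i) = (\<Sum>k\<in>UNIV. (matrix_of_columns v *v \<beta> i) $ k)"
    using size unfolding vec_size_def
    by (intro sum_matrix_vector_mult_const_column_sum[symmetric]) (simp add: matrix_of_columns_def)
  also have "matrix_of_columns v *v \<beta> i = \<gamma> + axis i 1"
    using inv by (simp add: inversion_data_def)
  finally show ?thesis
    by (simp add: vec_size_def sum.distrib axis_def)
qed

lemma inversion_data_det:
  fixes v :: "'n::finite \<Rightarrow> nat ^ 'n"
  assumes inv: "inversion_data v \<beta> \<gamma>"
  shows "det_nat (matrix_of_columns v) * det_nat (matrix_of_columns \<beta>) = 1 + real (vec_size \<gamma>)"
proof -
  let ?A = "map_matrix real (matrix_of_columns v)" and ?B = "map_matrix real (matrix_of_columns \<beta>)"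
  have "(?A ** ?B) $ k $ i = real (\<gamma> $ k) + (if k = i then 1 else 0)" for k i
    using arg_cong[OF inversion_data_entry[OF inv, of k i], of real]
    by (simp add: map_matrix_def matrix_of_columns_def matrix_matrix_mult_def)
  \<comment> \<open>Written in the shape \<open>I + u 1^T\<close> with \<open>u\<close> the real
    image of \<gamma>.\<close>
  then have "?A ** ?B = (\<chi> k i. (\<chi> k. real (\<gamma> $ k)) $ k + (if k = i then 1 else 0))"
    by (simp add: vec_eq_iff)
  then have "det (?A ** ?B) = 1 + (\<Sum>k\<in>UNIV. real (\<gamma> $ k))"
    by (simp only: det_identity_plus_constant_rows) simp
  then show ?thesis
    by (simp add: det_nat_def det_mul vec_size_def)
qed

theorem theorem2p2:
  fixes v :: "'n::finite \<Rightarrow> nat ^ 'n" and d :: nat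
  assumes "CARD('n) \<ge> 2"
    and "d \<ge> 1"
    and "\<forall>i. vec_size (v i) = d"
    and "det_nat (matrix_of_columns v) \<in> {real d, - real d}"
  shows "(\<exists>!(\<beta>, \<gamma>). inversion_data v \<beta> \<gamma>) \<and>
    (\<forall>\<beta> \<gamma>. inversion_data v \<beta> \<gamma> \<longrightarrow>
       det_nat (matrix_of_columns \<beta>) \<in>
         {(real (vec_size \<gamma>) + 1) / real d, - ((real (vec_size \<gamma>) + 1) / real d)} \<and>
       (\<forall>i. det_nat (matrix_of_columns \<beta>) \<in>
         {real (vec_size (\<beta> i)), - real (vec_size (\<beta> i))}))"
proof (intro conjI allI impI)
  have nz: "det_nat (matrix_of_columns v) \<noteq> 0"
    using assms(2,4) by auto
  obtain \<beta> \<gamma> where inv: "inversion_data v \<beta> \<gamma>"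
    using inversion_data_exists[of d v] assms by blast
  show "\<exists>!(\<beta>, \<gamma>). inversion_data v \<beta> \<gamma>"
  proof (rule ex1I[of _ "(\<beta>, \<gamma>)"])
    show "p = (\<beta>, \<gamma>)" if "case p of (\<beta>, \<gamma>) \<Rightarrow> inversion_data v \<beta> \<gamma>" for p
      using that inversion_data_unique[OF nz _ inv] by (cases p) auto
  qed (simp add: inv)
next
  fix \<beta> \<gamma>
  assume inv: "inversion_data v \<beta> \<gamma>"
  show det: "det_nat (matrix_of_columns \<beta>) \<in>
      {(real (vec_size \<gamma>) + 1) / real d, - ((real (vec_size \<gamma>) + 1) / real d)}"
    using inversion_data_det[OF inv] assms(2,4) by (auto simp: field_simps)
  fix i
  \<comment> \<open>The two claimed absolute values of the determinant coincide, so the second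
    membership is the first one rewritten.\<close>
  have "real d * real (vec_size (\<beta> i)) = real (vec_size \<gamma>) + 1"
    using arg_cong[OF inversion_data_size[of v d \<beta> \<gamma> i], of real] assms(3) inv by simp
  then have "(real (vec_size \<gamma>) + 1) / real d = real (vec_size (\<beta> i))"
    using assms(2) by (simp add: field_simps)
  then show "det_nat (matrix_of_columns \<beta>) \<in> {real (vec_size (\<beta> i)), - real (vec_size (\<beta> i))}"
    using det by simp
qed

end
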